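(* Let $A=2I$ on $\mathbb{R}^n$. There exists a weight $w$ such that $w\in\mathcal{A}_2$ and $w\notin\mathcal{A}_{A,2}$. Moreover, the weight $w$ does not satisfy the condition $w(Ax)\lesssim w(x)$ for a.e. $x$.
   Context: A weight is a locally integrable function $w$ on $\mathbb{R}^n$ with $0<w<\infty$ a.e. Cubes $Q$ have sides parallel to the axes, and $w_A(x)=w(Ax)$. For an invertible matrix $A$, a weight $w$ belongs to $\mathcal{A}_{A,2}$ if $\sup_Q \left(\frac1{|Q|}\int_Q w_A(x)\,dx\right)\left(\frac1{|Q|}\int_Q w(x)^{-1}\,dx\right)<\infty$; $\mathcal{A}_2=\mathcal{A}_{I,2}$ is the classical Muckenhoupt class. The notation $w(Ax)\lesssim w(x)$ a.e. means that there is a constant $C>0$ with $w(Ax)\le C\,w(x)$ for a.e. $x$. *)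

theory Defs
  imports "HOL-Analysis.Analysis"
begin

text \<open>
  Weights are modelled as real-valued functions, so that \<open>w < \<infinity>\<close> holds by typing; positivity is
  only required almost everywhere.
\<close>

definition locally_integrable :: "(real^'n \<Rightarrow> real) \<Rightarrow> bool" where
  "locally_integrable f \<longleftrightarrow> (\<forall>K. compact K \<longrightarrow> set_integrable lebesgue K f)"

definition weight :: "(real^'n \<Rightarrow> real) \<Rightarrow> bool" where
  "weight w \<longleftrightarrow> locally_integrable w \<and> (AE x in lebesgue. 0 < w x)"

definition cubes :: "(real^'n) set set" where
  "cubes = {cbox a (a + vec l) | a l. 0 < l}"

text \<open>
  Averages are taken in \<open>[0, \<infinity>]\<close>, since \<open>1 / w\<close> need not be locally integrable. They are only
  applied to functions that are positive almost everywhere; the truncation of negative values by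
  \<open>ennreal\<close> then concerns a null set only.
\<close>

definition average :: "(real^'n) set \<Rightarrow> (real^'n \<Rightarrow> real) \<Rightarrow> ennreal" where
  "average Q f = (\<integral>\<^sup>+x\<in>Q. ennreal (f x) \<partial>lebesgue) / emeasure lebesgue Q"

text \<open>
  The class \<open>\<A>\<^bsub>A,2\<^esub>\<close>, meant for invertible \<open>A\<close>. For such \<open>A\<close> and a weight \<open>w\<close> all the averages are
  positive, and those of \<open>w(Ax)\<close> are finite, so the convention \<open>0 * \<infinity> = 0\<close> plays no role.
\<close>

definition A2_class :: "real^'n^'n \<Rightarrow> (real^'n \<Rightarrow> real) set" where
  "A2_class A = {w. weight w \<and>
     (SUP Q\<in>cubes. average Q (\<lambda>x. w (A *v x)) * average Q (\<lambda>x. inverse (w x))) < \<infinity>}"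

abbreviation Muckenhoupt_A2 :: "(real^'n \<Rightarrow> real) set" where
  "Muckenhoupt_A2 \<equiv> A2_class (mat 1)"

end

theory Submission
  imports Defs
begin

text \<open>
  The witness is \<open>w x = 1 / sqrt \<bar>x $ k - 1\<bar>\<close> for a fixed coordinate \<open>k\<close>. By Fubini its average over a
  cube is that of \<open>1 / sqrt \<bar>t - 1\<bar>\<close> over an interval; if \<open>M\<close> is the largest value of \<open>\<bar>t - 1\<bar>\<close> there,
  this is at most \<open>4 / sqrt M\<close>, while \<open>1 / w \<le> sqrt M\<close>, whence \<open>w \<in> \<A>\<^sub>2\<close>. On the other
  hand \<open>w (2 x)\<close> is singular along \<open>x $ k = 1 / 2\<close>, where \<open>w\<close> is bounded above and below, so small
  cubes near that hyperplane violate both remaining conditions.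
\<close>

section \<open>Averages over cubes\<close>

lemma emeasure_lebesgue_cube:
  fixes a :: "real^'n"
  assumes "0 < l"
  shows "emeasure lebesgue (cbox a (a + vec l)) = ennreal (l ^ CARD('n))"
proof -
  have "l = (vec l :: real^'n) \<bullet> b" if "b \<in> Basis" for b
    using that by (auto simp: Basis_vec_def inner_axis)
  then have "(\<Prod>b\<in>Basis. (a + vec l - a) \<bullet> b) = (\<Prod>b\<in>(Basis :: (real^'n) set). l)"
    by (intro prod.cong) auto
  moreover have "a \<bullet> b \<le> (a + vec l) \<bullet> b" if "b \<in> Basis" for b
    using that assms by (auto simp: Basis_vec_def inner_axis)
  ultimately show ?thesis
    by (subst emeasure_completion) (auto simp: emeasure_lborel_cbox_eq)
qed

lemma average_mono:
  assumes "\<And>x. x \<in> Q \<Longrightarrow> f x \<le> g x"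
  shows "average Q f \<le> average Q g"
  unfolding average_def
  by (intro divide_right_mono_ennreal nn_integral_mono)
    (auto simp: indicator_def assms intro: ennreal_leI)

lemma average_cube_const:
  fixes a :: "real^'n"
  assumes "0 < l"
  shows "average (cbox a (a + vec l)) (\<lambda>x. c) = ennreal c"
proof -
  have "ennreal (l ^ CARD('n)) \<noteq> 0"
    using assms by (simp add: ennreal_eq_0_iff not_le)
  then show ?thesis
    unfolding average_def
    by (simp add: nn_integral_cmult_indicator emeasure_lebesgue_cube[OF assms]
        mult_divide_eq_ennreal del: emeasure_completion)
qed

text \<open>Fubini in product form: on the cube the integrand splits into one factor per basis
  vector. The factor for \<open>axis k 1\<close> carries \<open>g\<close>; each other one is an
  interval indicator with integral \<open>l\<close>.\<close>

lemma average_cube_coordinate: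
  fixes a :: "real^'n" and g :: "real \<Rightarrow> real"
  assumes l: "0 < l" and g[measurable]: "g \<in> borel_measurable borel"
  shows "average (cbox a (a + vec l)) (\<lambda>x. g (x $ k))
    = (\<integral>\<^sup>+t\<in>{a $ k .. a $ k + l}. ennreal (g t) \<partial>lborel) / ennreal l"
proof -
  let ?B = "Basis :: (real^'n) set" and ?e = "axis k 1 :: real^'n"
  let ?I = "\<integral>\<^sup>+t\<in>{a $ k .. a $ k + l}. ennreal (g t) \<partial>lborel"
  define f where "f b t =
      indicator {a \<bullet> b .. a \<bullet> b + l} t * (if b = ?e then ennreal (g t) else 1)"
    for b :: "real^'n" and t :: real
  have e: "?e \<in> ?B"
    by (auto simp: Basis_vec_def)
  have vec: "(a + vec l) \<bullet> b = a \<bullet> b + l" if "b \<in> ?B" for b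
    using that by (auto simp: Basis_vec_def inner_axis)
  have prod_f: "ennreal (g (x $ k)) * indicator (cbox a (a + vec l)) x = (\<Prod>b\<in>?B. f b (x \<bullet> b))" for x
  proof -
    have "(\<Prod>b\<in>?B. f b (x \<bullet> b)) = (\<Prod>b\<in>?B. indicator {a \<bullet> b .. a \<bullet> b + l} (x \<bullet> b))
        * (\<Prod>b\<in>?B. if b = ?e then ennreal (g (x \<bullet> b)) else 1)"
      by (simp add: f_def prod.distrib)
    also have "(\<Prod>b\<in>?B. if b = ?e then ennreal (g (x \<bullet> b)) else 1) = ennreal (g (x $ k))"
      using e by (simp add: inner_axis)
    also have "(\<Prod>b\<in>?B. indicator {a \<bullet> b .. a \<bullet> b + l} (x \<bullet> b)) =
        (indicator (cbox a (a + vec l)) x :: ennreal)"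
    proof (cases "x \<in> cbox a (a + vec l)")
      case True
      then show ?thesis
        by (auto simp: mem_box vec intro!: prod.neutral)
    next
      case False
      then obtain b where "b \<in> ?B" "x \<bullet> b \<notin> {a \<bullet> b .. a \<bullet> b + l}"
        by (auto simp: mem_box vec)
      then show ?thesis
        using False by (subst prod_zero) (auto intro!: bexI[of _ b])
    qed
    finally show ?thesis
      by (simp add: mult.commute)
  qed
  have f_meas: "f b \<in> borel_measurable borel" for b
    unfolding f_def by measurable
  have "(\<integral>\<^sup>+x\<in>cbox a (a + vec l). ennreal (g (x $ k)) \<partial>lebesgue) =
      (\<integral>\<^sup>+x. (\<Prod>b\<in>?B. f b (x \<bullet> b)) \<partial>lborel)"
    by (simp add: prod_f nn_integral_completion)
  also have "\<dots> = (\<Prod>b\<in>?B. \<integral>\<^sup>+t. f b t \<partial>lborel)"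
    by (rule nn_integral_lborel_prod) (auto simp: f_meas)
  also have "\<dots> = (\<integral>\<^sup>+t. f ?e t \<partial>lborel) * (\<Prod>b\<in>?B - {?e}. \<integral>\<^sup>+t. f b t \<partial>lborel)"
    using e by (intro prod.remove) auto
  also have "(\<integral>\<^sup>+t. f ?e t \<partial>lborel) = ?I"
    by (auto simp: f_def inner_axis mult.commute intro!: nn_integral_cong)
  also have "(\<Prod>b\<in>?B - {?e}. \<integral>\<^sup>+t. f b t \<partial>lborel) = (\<Prod>b\<in>?B - {?e}. ennreal l)"
    using l by (intro prod.cong) (auto simp: f_def)
  also have "\<dots> = ennreal (l ^ (CARD('n) - 1))"
    using e l by (simp add: ennreal_power card_Diff_singleton)
  finally have int: "(\<integral>\<^sup>+x\<in>cbox a (a + vec l). ennreal (g (x $ k)) \<partial>lebesgue) =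
      ennreal (l ^ (CARD('n) - 1)) * ?I"
    by (simp add: mult.commute)
  \<comment> \<open>The dimension is at least 1, so the truncated subtraction is exact. Cancelling
    the nonzero power \<open>l ^ (CARD('n) - 1)\<close> leaves a single \<open>l\<close> in the
    denominator.\<close>
  have "l ^ CARD('n) = l ^ (CARD('n) - 1) * l"
    by (metis One_nat_def Suc_pred mult.commute power_Suc zero_less_card_finite)
  then have "ennreal (l ^ CARD('n)) = ennreal (l ^ (CARD('n) - 1)) * ennreal l"
    using l by (simp add: ennreal_mult)
  moreover have "ennreal (l ^ (CARD('n) - 1)) \<noteq> 0"
    using l by (simp add: ennreal_eq_0_iff not_le)
  ultimately show ?thesis
    unfolding average_def int emeasure_lebesgue_cube[OF l]
    using divide_mult_eq[of "ennreal (l ^ (CARD('n) - 1))" ?I "ennreal l"]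
    by (simp add: mult.commute)
qed

section \<open>One-dimensional calculus for the odd square root\<close>

text \<open>Here \<open>sqrt\<close> is Isabelle's odd extension to the negative reals, an antiderivative on both sides
  of the singularity.\<close>

lemma nn_integral_inverse_sqrt_abs:
  fixes a b c :: real
  assumes "a \<le> b"
  shows "(\<integral>\<^sup>+t\<in>{a..b}. ennreal (1 / sqrt \<bar>t - c\<bar>) \<partial>lborel)
    = ennreal (2 * sqrt (b - c) - 2 * sqrt (a - c))"
proof -
  have "((\<lambda>t. 1 / sqrt \<bar>t - c\<bar>) has_integral 2 * sqrt (b - c) - 2 * sqrt (a - c)) {a..b}"
  \<comment> \<open>The antiderivative is continuous everywhere, so the one point \<open>c\<close>
    without a derivative may be excluded.\<close>
  proof (rule fundamental_theorem_of_calculus_interior_strong[where S = "{c}"])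
    show "((\<lambda>t. 2 * sqrt (t - c)) has_vector_derivative 1 / sqrt \<bar>t - c\<bar>) (at t)"
      if "t \<in> {a<..<b} - {c}" for t
    proof -
      \<comment> \<open>For \<open>t < c\<close> the root of \<open>t - c\<close> is negative, so
        the minus sign makes \<open>D\<close> positive on both sides.\<close>
      define D where "D =
          (if t > c then inverse (sqrt (t - c)) / 2 else - (inverse (sqrt (t - c)) / 2))"
      have "DERIV sqrt (t - c) :> D"
        using that by (intro DERIV_real_sqrt_generic) (auto simp: D_def)
      then have "((\<lambda>t. sqrt (t - c)) has_real_derivative D) (at t)"
        using DERIV_shift[of sqrt D t "- c"] by simp
      then have "((\<lambda>t. 2 * sqrt (t - c)) has_real_derivative 2 * D) (at t)"
        by (rule DERIV_cmult)
      moreover have "2 * D = 1 / sqrt \<bar>t - c\<bar>"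
        using that real_sqrt_minus[of "t - c"] by (auto simp: D_def divide_simps abs_if)
      ultimately show ?thesis
        by (simp add: has_real_derivative_iff_has_vector_derivative)
    qed
  qed (use assms in \<open>auto intro!: continuous_intros\<close>)
  then show ?thesis
    by (intro nn_integral_has_integral_lebesgue') auto
qed

text \<open>In terms of the signed roots \<open>p\<close> and \<open>q\<close> this is a quadratic
  inequality. If they do not have opposite signs, the difference of the two sides factors through
  \<open>q - p\<close>; otherwise \<open>q - p\<close> is at most twice the larger modulus.\<close>

lemma sqrt_diff_bound:
  fixes a b :: real
  assumes "a \<le> b"
  shows "(sqrt b - sqrt a) * sqrt (max \<bar>a\<bar> \<bar>b\<bar>) \<le> 2 * (b - a)"
proof -
  define p q where "p = sqrt a" and "q = sqrt b"
  have ab: "a = p * \<bar>p\<bar>" "b = q * \<bar>q\<bar>"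
    using real_sqrt_minus[of a] real_sqrt_minus[of b] unfolding p_def q_def
    by (auto simp: abs_if)
  have "p \<le> q"
    using assms by (simp add: p_def q_def)
  have "sqrt (max \<bar>a\<bar> \<bar>b\<bar>) = max \<bar>p\<bar> \<bar>q\<bar>"
    by (simp add: max_def p_def q_def real_sqrt_abs' flip: real_sqrt_abs')
  moreover have "(q - p) * max \<bar>p\<bar> \<bar>q\<bar> \<le> 2 * (q * \<bar>q\<bar> - p * \<bar>p\<bar>)"
  proof -
    consider "0 \<le> p" | "q \<le> 0" | "p < 0" "0 < q"
      by linarith
    then show ?thesis
    proof cases
      case 1
      then have "0 \<le> (q - p) * (q + 2 * p)"
        using \<open>p \<le> q\<close> by simp
      then show ?thesis
        using 1 \<open>p \<le> q\<close> by (simp add: max_def algebra_simps)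
    next
      case 2
      then have "0 \<le> (q - p) * (- p - 2 * q)"
        using \<open>p \<le> q\<close> by (intro mult_nonneg_nonneg) auto
      then show ?thesis
        using 2 \<open>p \<le> q\<close> by (simp add: max_def algebra_simps)
    next
      case 3
      define M where "M = max \<bar>p\<bar> \<bar>q\<bar>"
      have "(q - p) * M \<le> (2 * M) * M"
        by (intro mult_right_mono) (auto simp: M_def)
      also have "\<dots> \<le> 2 * (q * q + p * p)"
        by (auto simp: M_def max_def mult.assoc)
      finally show ?thesis
        using 3 by (simp add: M_def)
    qed
  qed
  ultimately show ?thesis
    unfolding p_def [symmetric] q_def [symmetric] using ab by simp
qed

text \<open>On the hyperplane itself \<open>1 / 0 = 0\<close> makes the weight vanish, so it is positive only almost
  everywhere.\<close>

definition hyperplane_weight :: "'n \<Rightarrow> real^'n \<Rightarrow> real" where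
  "hyperplane_weight k x = 1 / sqrt \<bar>x $ k - 1\<bar>"

lemma average_hyperplane_weight:
  assumes "0 < l"
  shows "average (cbox a (a + vec l)) (hyperplane_weight k)
    = ennreal (2 * (sqrt (a $ k + l - 1) - sqrt (a $ k - 1)) / l)"
proof -
  have "average (cbox a (a + vec l)) (hyperplane_weight k)
      = ennreal (2 * sqrt (a $ k + l - 1) - 2 * sqrt (a $ k - 1)) / ennreal l"
    using average_cube_coordinate[OF assms, of "\<lambda>t. 1 / sqrt \<bar>t - 1\<bar>" a k]
      nn_integral_inverse_sqrt_abs[of "a $ k" "a $ k + l" 1] assms
    by (simp add: hyperplane_weight_def[abs_def])
  also have "\<dots> = ennreal ((2 * sqrt (a $ k + l - 1) - 2 * sqrt (a $ k - 1)) / l)"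
    using assms by (intro divide_ennreal) auto
  finally show ?thesis
    by (simp add: algebra_simps)
qed

lemma average_hyperplane_weight_product_le:
  fixes a :: "real^'n"
  assumes "0 < l"
  shows "average (cbox a (a + vec l)) (hyperplane_weight k)
    * average (cbox a (a + vec l)) (\<lambda>x. inverse (hyperplane_weight k x)) \<le> 4"
proof -
  \<comment> \<open>Signed distances from the two faces of the cube orthogonal to
    \<open>axis k 1\<close> to the singular hyperplane.\<close>
  define u v where "u = a $ k - 1" and "v = a $ k + l - 1"
  have uv: "u \<le> v" "v - u = l"
    using assms by (auto simp: u_def v_def)
  have "average (cbox a (a + vec l)) (\<lambda>x. inverse (hyperplane_weight k x))
      \<le> average (cbox a (a + vec l)) (\<lambda>x. sqrt (max \<bar>u\<bar> \<bar>v\<bar>))"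
  proof (rule average_mono)
    fix x assume "x \<in> cbox a (a + vec l)"
    then have "a $ k \<le> x $ k" "x $ k \<le> a $ k + l"
      by (auto simp: mem_box_cart)
    then have "\<bar>x $ k - 1\<bar> \<le> max \<bar>u\<bar> \<bar>v\<bar>"
      by (auto simp: u_def v_def)
    \<comment> \<open>This covers the hyperplane too: there both the weight and its inverse are 0 by
      convention.\<close>
    then show "inverse (hyperplane_weight k x) \<le> sqrt (max \<bar>u\<bar> \<bar>v\<bar>)"
      unfolding hyperplane_weight_def by simp
  qed
  then have "average (cbox a (a + vec l)) (hyperplane_weight k)
      * average (cbox a (a + vec l)) (\<lambda>x. inverse (hyperplane_weight k x))
      \<le> ennreal (2 * (sqrt v - sqrt u) / l) * ennreal (sqrt (max \<bar>u\<bar> \<bar>v\<bar>))"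
    unfolding average_cube_const[OF assms] average_hyperplane_weight[OF assms] u_def v_def
    by (intro mult_left_mono) auto
  also have "\<dots> = ennreal (2 * ((sqrt v - sqrt u) * sqrt (max \<bar>u\<bar> \<bar>v\<bar>)) / l)"
    using uv assms by (subst ennreal_mult[symmetric]) auto
  \<comment> \<open>One factor 2 comes from the antiderivative, the other from
    \<open>sqrt_diff_bound\<close>; the length \<open>v - u = l\<close> cancels.\<close>
  also have "\<dots> \<le> ennreal 4"
    using sqrt_diff_bound[OF uv(1)] uv(2) assms
    by (intro ennreal_leI) (simp add: pos_divide_le_eq)
  finally show ?thesis
    by simp
qed

text \<open>A compact set lies in a cube, over which the average is finite by the explicit formula.
  Positivity fails only on a hyperplane, which is a null set.\<close>

lemma weight_hyperplane_weight: "weight (hyperplane_weight k)"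
  unfolding weight_def
proof
  have meas: "hyperplane_weight k \<in> borel_measurable lebesgue"
    unfolding hyperplane_weight_def[abs_def]
    by (intro measurable_completion) simp
  show "locally_integrable (hyperplane_weight k)"
    unfolding locally_integrable_def
  proof (intro allI impI)
    fix K :: "(real^'a) set" assume "compact K"
    then obtain B where B: "0 < B" "\<And>x. x \<in> K \<Longrightarrow> norm x \<le> B"
      by (meson bounded_pos compact_imp_bounded)
    define a :: "real^'a" where "a = vec (- B)"
    define Q where "Q = cbox a (a + vec (2 * B))"
    have "x \<in> Q" if "x \<in> K" for x
      unfolding Q_def a_def mem_box_cart
    proof
      fix i
      show "vec (- B) $ i \<le> x $ i \<and> x $ i \<le> (vec (- B) + vec (2 * B)) $ i"
        using component_le_norm_cart[of x i] B(2)[OF that] by auto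
    qed
    then have "K \<subseteq> Q" by blast
    have "average Q (hyperplane_weight k) < top"
      using B(1) by (simp add: Q_def average_hyperplane_weight)
    moreover have "emeasure lebesgue Q < top"
      using B(1) unfolding Q_def by (subst emeasure_lebesgue_cube) auto
    ultimately have "(\<integral>\<^sup>+x\<in>Q. ennreal (hyperplane_weight k x) \<partial>lebesgue) < top"
      by (auto simp: average_def ennreal_divide_eq_top_iff less_top[symmetric]
          simp del: emeasure_completion)
    moreover have "ennreal (indicator Q x * hyperplane_weight k x)
        = ennreal (hyperplane_weight k x) * indicator Q x" for x
      by (simp add: indicator_def)
    moreover have "(\<lambda>x. indicator Q x * hyperplane_weight k x) \<in> borel_measurable lebesgue"
      using meas by (intro borel_measurable_times borel_measurable_indicator) (auto simp: Q_def)
    moreover have "0 \<le> indicator Q x * hyperplane_weight k x" for x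
      by (simp add: hyperplane_weight_def)
    ultimately have "integrable lebesgue (\<lambda>x. indicator Q x * hyperplane_weight k x)"
      by (intro integrableI_nonneg) auto
    then have "set_integrable lebesgue Q (hyperplane_weight k)"
      by (simp add: set_integrable_def)
    then show "set_integrable lebesgue K (hyperplane_weight k)"
      using \<open>K \<subseteq> Q\<close> \<open>compact K\<close>
      by (auto intro: set_integrable_subset lmeasurable_compact fmeasurableD)
  qed
  have "negligible {x :: real^'a. x $ k = 1}"
    using negligible_standard_hyperplane[of "axis k 1 :: real^'a" 1]
    by (auto simp: inner_axis Basis_vec_def)
  then have "AE x :: real^'a in lebesgue. x $ k \<noteq> 1"
    using AE_not_in[of "{x. x $ k = 1}" lebesgue]
    by (auto simp: negligible_iff_null_sets)
  then show "AE x in lebesgue. 0 < hyperplane_weight k x"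
    by eventually_elim (auto simp: hyperplane_weight_def)
qed

lemma Muckenhoupt_A2_hyperplane_weight: "hyperplane_weight k \<in> Muckenhoupt_A2"
proof -
  have "(SUP Q\<in>cubes. average Q (\<lambda>x. hyperplane_weight k (mat 1 *v x))
      * average Q (\<lambda>x. inverse (hyperplane_weight k x))) \<le> 4"
    by (rule SUP_least) (auto simp: cubes_def average_hyperplane_weight_product_le)
  also have "(4 :: ennreal) < \<infinity>"
    by simp
  finally show ?thesis
    by (simp add: A2_class_def weight_hyperplane_weight)
qed

section \<open>Failure under the dilation\<close>

text \<open>Both negative claims rest on these cubes: the dilated weight is arbitrarily large there
  while the weight itself stays at most 2.\<close>

lemma hyperplane_weight_dilation_blowup:
  fixes R :: real and k :: "'n::finite"
  assumes "0 < R"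
  obtains a :: "real^'n" and l where "0 < l"
    and "\<And>x. x \<in> cbox a (a + vec l) \<Longrightarrow> R \<le> hyperplane_weight k (2 *\<^sub>R x)"
    and "\<And>x. x \<in> cbox a (a + vec l) \<Longrightarrow> 1 / 2 \<le> inverse (hyperplane_weight k x)"
proof -
  \<comment> \<open>The bound \<open>1 / 8\<close> keeps \<open>x $ k\<close> at most
    \<open>3 / 4\<close>, hence at distance at least \<open>1 / 4\<close> from 1. The other bound
    gives \<open>2 * x $ k - 1 \<le> 4 * l \<le> (1 / R)\<^sup>2\<close>.\<close>
  define l where "l = min (1 / 8) (1 / (4 * R\<^sup>2))"
  have l: "0 < l" "l \<le> 1 / 8" "4 * l \<le> (1 / R)\<^sup>2"
    using assms by (auto simp: l_def min_def field_simps)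
  \<comment> \<open>The shift by \<open>l\<close> keeps the cube off the hyperplane
    \<open>x $ k = 1 / 2\<close>, where the convention \<open>1 / 0 = 0\<close> would make the
    dilated weight vanish.\<close>
  define a :: "real^'n" where "a = vec (1 / 2 + l)"
  have *: "1 / 2 + l \<le> x $ k" "x $ k \<le> 1 / 2 + 2 * l" if "x \<in> cbox a (a + vec l)" for x
    using that by (auto simp: mem_box_cart a_def dest!: spec[of _ k])
  show thesis
  proof (rule that[of l a])
    fix x assume "x \<in> cbox a (a + vec l)"
    note x = *[OF this]
    have "sqrt \<bar>2 * x $ k - 1\<bar> \<le> 1 / R"
      using x l assms by (intro real_le_lsqrt) auto
    moreover have "0 < sqrt \<bar>2 * x $ k - 1\<bar>"
      using x l by simp
    ultimately show "R \<le> hyperplane_weight k (2 *\<^sub>R x)"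
      using assms by (simp add: hyperplane_weight_def field_simps)
    have "1 / 2 \<le> sqrt \<bar>x $ k - 1\<bar>"
      using x l by (intro real_le_rsqrt) (auto simp: power2_eq_square)
    then show "1 / 2 \<le> inverse (hyperplane_weight k x)"
      by (simp add: hyperplane_weight_def)
  qed (rule l)
qed

lemma hyperplane_weight_not_in_A2_class_dilation:
  "hyperplane_weight k \<notin> A2_class (2 *\<^sub>R mat 1)"
proof
  let ?w = "hyperplane_weight k"
  let ?S = "SUP Q\<in>cubes. average Q (\<lambda>x. ?w (2 *\<^sub>R x)) * average Q (\<lambda>x. inverse (?w x))"
  assume "?w \<in> A2_class (2 *\<^sub>R mat 1)"
  then have "?S < top"
    by (simp add: A2_class_def scaleR_matrix_vector_assoc[symmetric])
  then obtain r where r: "0 \<le> r" "?S = ennreal r"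
    by (cases ?S) auto
  \<comment> \<open>The factor 2 offsets the lower bound \<open>1 / 2\<close> for the inverse, so
    the product of averages is at least \<open>r + 1\<close>, above the supposed supremum
    \<open>r\<close>.\<close>
  obtain a :: "real^'a" and l where l: "0 < l"
    and *: "\<And>x. x \<in> cbox a (a + vec l) \<Longrightarrow> 2 * (r + 1) \<le> ?w (2 *\<^sub>R x)"
      "\<And>x. x \<in> cbox a (a + vec l) \<Longrightarrow> 1 / 2 \<le> inverse (?w x)"
    using hyperplane_weight_dilation_blowup[of "2 * (r + 1)" k] r(1)
    by (metis add_nonneg_pos mult_pos_pos zero_less_numeral zero_less_one)
  let ?Q = "cbox a (a + vec l)"
  have "ennreal (r + 1) = ennreal (2 * (r + 1)) * ennreal (1 / 2)"
    using r(1) by (subst ennreal_mult[symmetric]) (auto simp del: ennreal_plus)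
  also have "\<dots> \<le> average ?Q (\<lambda>x. ?w (2 *\<^sub>R x)) * average ?Q (\<lambda>x. inverse (?w x))"
    unfolding average_cube_const[OF l, of a, symmetric]
    by (intro mult_mono average_mono *) auto
  also have "\<dots> \<le> ?S"
    using l by (intro SUP_upper) (auto simp: cubes_def)
  finally show False
    using r by (simp add: ennreal_le_iff)
qed

lemma hyperplane_weight_dilation_not_dominated:
  assumes "0 < C"
  shows "\<not> (AE x in lebesgue. hyperplane_weight k (2 *\<^sub>R x) \<le> C * hyperplane_weight k x)"
proof
  let ?w = "hyperplane_weight k"
  assume AE: "AE x in lebesgue. ?w (2 *\<^sub>R x) \<le> C * ?w x"
  \<comment> \<open>As the weight is at most 2 on the cube, any value above \<open>2 * C\<close>
    breaks the domination at every point of it.\<close>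
  obtain a :: "real^'a" and l where l: "0 < l"
    and *: "\<And>x. x \<in> cbox a (a + vec l) \<Longrightarrow> 2 * C + 1 \<le> ?w (2 *\<^sub>R x)"
      "\<And>x. x \<in> cbox a (a + vec l) \<Longrightarrow> 1 / 2 \<le> inverse (?w x)"
    using hyperplane_weight_dilation_blowup[of "2 * C + 1" k] assms
    by (metis add_pos_pos mult_pos_pos zero_less_numeral zero_less_one)
  have "C * ?w x < ?w (2 *\<^sub>R x)" if "x \<in> cbox a (a + vec l)" for x
  proof -
    have "?w x \<le> 2"
      using le_imp_inverse_le[OF *(2)[OF that]] by simp
    then have "C * ?w x \<le> C * 2"
      using assms by (intro mult_left_mono) auto
    then show ?thesis
      using *(1)[OF that] by linarith
  qed
  \<comment> \<open>The cube would have to be a null set, although its side is positive.\<close>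
  with AE have "AE x in lebesgue. x \<notin> cbox a (a + vec l)"
    by (auto elim!: eventually_mono simp: not_le[symmetric])
  then have "emeasure lebesgue (cbox a (a + vec l)) = 0"
    by (subst (asm) AE_iff_null_sets[symmetric]) auto
  moreover have "0 < l ^ CARD('a)"
    using l by simp
  ultimately show False
    by (simp add: emeasure_lebesgue_cube[OF l] ennreal_eq_0_iff del: emeasure_completion)
qed

theorem proposition1p6:
  fixes A :: "real^'n^'n"
  assumes "A = 2 *\<^sub>R mat 1"
  shows "\<exists>w. weight w \<and> w \<in> Muckenhoupt_A2 \<and> w \<notin> A2_class A \<and>
           \<not> (\<exists>C>0. AE x in lebesgue. w (A *v x) \<le> C * w x)"
proof -
  \<comment> \<open>Any coordinate serves; index types are nonempty.\<close>
  obtain k :: 'n where True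
    by simp
  have "A *v x = 2 *\<^sub>R x" for x
    by (simp add: assms scaleR_matrix_vector_assoc[symmetric])
  then show ?thesis
    using weight_hyperplane_weight[of k] Muckenhoupt_A2_hyperplane_weight[of k]
      hyperplane_weight_not_in_A2_class_dilation[of k]
      hyperplane_weight_dilation_not_dominated
    by (intro exI[of _ "hyperplane_weight k"]) (auto simp: assms)
qed

end
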